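(* Let $G$ and $H$ be discrete groups. If $(\ell^{1}(G),* ) \equiv (\ell^{1}(H),* )$ as $\mathcal{L}_{\mathrm{cnv}}$-structures, then $(G,\cdot)\equiv (H,\cdot)$ as (classical first-order) structures in the language of pure groups.
   Context: For a discrete group $G$, $(\ell^1(G),* )$ denotes the convolution algebra of $G$: the real Banach lattice $\ell^1(G)$ (functions $f:G\to\mathbb{R}$ with $\|f\|=\sum_{x}|f(x)|<\infty$, pointwise order) equipped with convolution $(f*g)(x)=\sum_{y\in G}f(y)g(y^{-1}x)$. It is regarded as a metric structure in continuous first-order logic in the language $\mathcal{L}_{\mathrm{cnv}}=\{+,0,\wedge,\vee,\|\cdot\|,*\}$ with metric $d(f,g)=\|f-g\|$; formally one works in the unit ball, treating $+,\wedge,\vee$ as maps from the unit ball to the ball of radius $2$ (or rescaling them by $1/2$). $\equiv$ between convolution algebras is elementary equivalence in continuous logic. The language of pure groups is $\mathcal{L}_{\mathrm{grp}}=\{\cdot\}$, and $\equiv$ between groups is classical elementary equivalence. *)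

theory Defs
  imports "HOL-Algebra.Group" "HOL-Analysis.Infinite_Sum" "HOL-Analysis.Function_Topology"
begin

datatype gterm =
    GVar nat
  | GMult gterm gterm

datatype gform =
    GEq gterm gterm
  | GNot gform
  | GAnd gform gform
  | GEx nat gform

fun gterm_vars :: "gterm \<Rightarrow> nat set" where
  "gterm_vars (GVar n) = {n}"
| "gterm_vars (GMult s t) = gterm_vars s \<union> gterm_vars t"

fun gform_fv :: "gform \<Rightarrow> nat set" where
  "gform_fv (GEq s t) = gterm_vars s \<union> gterm_vars t"
| "gform_fv (GNot \<phi>) = gform_fv \<phi>"
| "gform_fv (GAnd \<phi> \<psi>) = gform_fv \<phi> \<union> gform_fv \<psi>"
| "gform_fv (GEx n \<phi>) = gform_fv \<phi> - {n}"

definition gsentence :: "gform \<Rightarrow> bool" where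
  "gsentence \<phi> \<longleftrightarrow> gform_fv \<phi> = {}"

fun gterm_val :: "('a, 'm) monoid_scheme \<Rightarrow> (nat \<Rightarrow> 'a) \<Rightarrow> gterm \<Rightarrow> 'a" where
  "gterm_val G v (GVar n) = v n"
| "gterm_val G v (GMult s t) = gterm_val G v s \<otimes>\<^bsub>G\<^esub> gterm_val G v t"

fun gsat :: "('a, 'm) monoid_scheme \<Rightarrow> (nat \<Rightarrow> 'a) \<Rightarrow> gform \<Rightarrow> bool" where
  "gsat G v (GEq s t) \<longleftrightarrow> gterm_val G v s = gterm_val G v t"
| "gsat G v (GNot \<phi>) \<longleftrightarrow> \<not> gsat G v \<phi>"
| "gsat G v (GAnd \<phi> \<psi>) \<longleftrightarrow> gsat G v \<phi> \<and> gsat G v \<psi>"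
| "gsat G v (GEx n \<phi>) \<longleftrightarrow> (\<exists>a\<in>carrier G. gsat G (v(n := a)) \<phi>)"

definition grp_elem_equiv :: "('a, 'm) monoid_scheme \<Rightarrow> ('b, 'n) monoid_scheme \<Rightarrow> bool" where
  "grp_elem_equiv G H \<longleftrightarrow>
     (\<forall>\<phi>. gsentence \<phi> \<longrightarrow>
       (\<forall>v w. range v \<subseteq> carrier G \<longrightarrow> range w \<subseteq> carrier H \<longrightarrow> gsat G v \<phi> = gsat H w \<phi>))"

record 'c cnv_structure =
  cuniv :: "'c set"
  czero :: 'c
  cadd :: "'c \<Rightarrow> 'c \<Rightarrow> 'c"
  cmeet :: "'c \<Rightarrow> 'c \<Rightarrow> 'c"
  cjoin :: "'c \<Rightarrow> 'c \<Rightarrow> 'c"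
  cconv :: "'c \<Rightarrow> 'c \<Rightarrow> 'c"
  cnorm :: "'c \<Rightarrow> real"
  cdist :: "'c \<Rightarrow> 'c \<Rightarrow> real"

datatype cterm =
    CVar nat
  | CZero
  | CAdd cterm cterm
  | CMeet cterm cterm
  | CJoin cterm cterm
  | CConv cterm cterm

text \<open>
  The connectives are all continuous functions from \<open>\<real>\<^sup>n\<close> to \<open>\<real>\<close>, for all \<open>n\<close>. An \<open>n\<close>-ary
  connective is given by a function on real sequences, continuous for the product topology
  (see \<open>cform_wf\<close>); it is applied to a list of \<open>n\<close> formulas by padding the list of their
  values with zeros. Such functions restrict to exactly the continuous functions on \<open>\<real>\<^sup>n\<close>.
\<close>

datatype cform =
    CNorm cterm
  | CDist cterm cterm
  | CConn "(nat \<Rightarrow> real) \<Rightarrow> real" "cform list"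
  | CSup nat cform
  | CInf nat cform

fun cform_wf :: "cform \<Rightarrow> bool" where
  "cform_wf (CNorm t) \<longleftrightarrow> True"
| "cform_wf (CDist s t) \<longleftrightarrow> True"
| "cform_wf (CConn u \<phi>s) \<longleftrightarrow> continuous_on UNIV u \<and> (\<forall>\<phi>\<in>set \<phi>s. cform_wf \<phi>)"
| "cform_wf (CSup n \<phi>) \<longleftrightarrow> cform_wf \<phi>"
| "cform_wf (CInf n \<phi>) \<longleftrightarrow> cform_wf \<phi>"

fun cterm_vars :: "cterm \<Rightarrow> nat set" where
  "cterm_vars (CVar n) = {n}"
| "cterm_vars CZero = {}"
| "cterm_vars (CAdd s t) = cterm_vars s \<union> cterm_vars t"
| "cterm_vars (CMeet s t) = cterm_vars s \<union> cterm_vars t"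
| "cterm_vars (CJoin s t) = cterm_vars s \<union> cterm_vars t"
| "cterm_vars (CConv s t) = cterm_vars s \<union> cterm_vars t"

fun cform_fv :: "cform \<Rightarrow> nat set" where
  "cform_fv (CNorm t) = cterm_vars t"
| "cform_fv (CDist s t) = cterm_vars s \<union> cterm_vars t"
| "cform_fv (CConn u \<phi>s) = (\<Union>\<phi>\<in>set \<phi>s. cform_fv \<phi>)"
| "cform_fv (CSup n \<phi>) = cform_fv \<phi> - {n}"
| "cform_fv (CInf n \<phi>) = cform_fv \<phi> - {n}"

definition csentence :: "cform \<Rightarrow> bool" where
  "csentence \<phi> \<longleftrightarrow> cform_wf \<phi> \<and> cform_fv \<phi> = {}"

fun cterm_val :: "('c, 'm) cnv_structure_scheme \<Rightarrow> (nat \<Rightarrow> 'c) \<Rightarrow> cterm \<Rightarrow> 'c" where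
  "cterm_val M v (CVar n) = v n"
| "cterm_val M v CZero = czero M"
| "cterm_val M v (CAdd s t) = cadd M (cterm_val M v s) (cterm_val M v t)"
| "cterm_val M v (CMeet s t) = cmeet M (cterm_val M v s) (cterm_val M v t)"
| "cterm_val M v (CJoin s t) = cjoin M (cterm_val M v s) (cterm_val M v t)"
| "cterm_val M v (CConv s t) = cconv M (cterm_val M v s) (cterm_val M v t)"

fun cform_val :: "('c, 'm) cnv_structure_scheme \<Rightarrow> (nat \<Rightarrow> 'c) \<Rightarrow> cform \<Rightarrow> real" where
  "cform_val M v (CNorm t) = cnorm M (cterm_val M v t)"
| "cform_val M v (CDist s t) = cdist M (cterm_val M v s) (cterm_val M v t)"
| "cform_val M v (CConn u \<phi>s) =
     u (\<lambda>i. if i < length \<phi>s then map (cform_val M v) \<phi>s ! i else 0)"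
| "cform_val M v (CSup n \<phi>) = (SUP a\<in>cuniv M. cform_val M (v(n := a)) \<phi>)"
| "cform_val M v (CInf n \<phi>) = (INF a\<in>cuniv M. cform_val M (v(n := a)) \<phi>)"

definition cnv_elem_equiv ::
    "('c, 'm) cnv_structure_scheme \<Rightarrow> ('d, 'n) cnv_structure_scheme \<Rightarrow> bool" where
  "cnv_elem_equiv M N \<longleftrightarrow>
     (\<forall>\<phi>. csentence \<phi> \<longrightarrow>
       (\<forall>v w. range v \<subseteq> cuniv M \<longrightarrow> range w \<subseteq> cuniv N \<longrightarrow> cform_val M v \<phi> = cform_val N w \<phi>))"

text \<open>Functions on the group are represented by functions vanishing off the carrier.\<close>

definition ell1 :: "('a, 'm) monoid_scheme \<Rightarrow> ('a \<Rightarrow> real) set" where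
  "ell1 G = {f. (\<forall>x. x \<notin> carrier G \<longrightarrow> f x = 0) \<and> f abs_summable_on carrier G}"

definition ell1_norm :: "('a, 'm) monoid_scheme \<Rightarrow> ('a \<Rightarrow> real) \<Rightarrow> real" where
  "ell1_norm G f = (\<Sum>\<^sub>\<infinity>x\<in>carrier G. \<bar>f x\<bar>)"

definition convolution ::
    "('a, 'm) monoid_scheme \<Rightarrow> ('a \<Rightarrow> real) \<Rightarrow> ('a \<Rightarrow> real) \<Rightarrow> 'a \<Rightarrow> real" where
  "convolution G f g x =
     (if x \<in> carrier G then \<Sum>\<^sub>\<infinity>y\<in>carrier G. f y * g (inv\<^bsub>G\<^esub> y \<otimes>\<^bsub>G\<^esub> x) else 0)"

text \<open>
  The metric structure lives on the closed unit ball; \<open>+\<close>, \<open>\<and>\<close> and \<open>\<or>\<close> are rescaled by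
  \<open>1/2\<close> so that they map the unit ball to itself.
\<close>

definition convolution_algebra :: "('a, 'm) monoid_scheme \<Rightarrow> ('a \<Rightarrow> real) cnv_structure" where
  "convolution_algebra G =
     \<lparr> cuniv = {f \<in> ell1 G. ell1_norm G f \<le> 1},
       czero = (\<lambda>x. 0),
       cadd = (\<lambda>f g x. (f x + g x) / 2),
       cmeet = (\<lambda>f g x. min (f x) (g x) / 2),
       cjoin = (\<lambda>f g x. max (f x) (g x) / 2),
       cconv = convolution G,
       cnorm = ell1_norm G,
       cdist = (\<lambda>f g. ell1_norm G (\<lambda>x. f x - g x)) \<rparr>"

end

theory Submission
  imports Defs
begin

text \<open>
  Every formula of group theory is translated into a formula of the convolution algebra that takes
  only the values 0 (true) and 1 (false) when its variables are assigned elements of the unit ball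
  close to point masses. The group quantifier becomes an infimum over the ball penalised by a
  formula detecting proximity to a point mass: \<open>f\<close> is close to a point mass iff its negative part
  is small and some \<open>g\<close> in the ball makes \<open>f * g\<close> close to a convolution unit. Indeed
  \<open>(f * g) \<one> = (\<Sum>\<^sub>\<infinity>y. f y * g (inv y)) > 1 - \<epsilon>\<close> and \<open>\<parallel>g\<parallel> \<le> 1\<close> force \<open>\<bar>f y\<bar> > 1 - \<epsilon>\<close> for some \<open>y\<close>.
\<close>

section \<open>The unit ball of the convolution algebra\<close>

abbreviation ell1_ball :: "('a, 'm) monoid_scheme \<Rightarrow> ('a \<Rightarrow> real) set" where
  "ell1_ball G \<equiv> {f \<in> ell1 G. ell1_norm G f \<le> 1}"

definition point_mass :: "'a \<Rightarrow> 'a \<Rightarrow> real" where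
  "point_mass a x = (if x = a then 1 else 0)"

section \<open>Norm estimates for functions concentrated near one group element\<close>

lemma ell1_summable:
  assumes "f \<in> ell1 G" and "S \<subseteq> carrier G"
  shows "(\<lambda>x. \<bar>f x\<bar>) summable_on S"
proof -
  have "(\<lambda>x. \<bar>f x\<bar>) summable_on carrier G"
    using assms(1) by (simp add: ell1_def)
  then show ?thesis
    using assms(2) by (rule summable_on_subset_banach)
qed

lemma ell1_norm_split:
  assumes "f \<in> ell1 G" and "a \<in> carrier G"
  shows "ell1_norm G f = \<bar>f a\<bar> + (\<Sum>\<^sub>\<infinity>x\<in>carrier G - {a}. \<bar>f x\<bar>)"
proof -
  have "infsum (\<lambda>x. \<bar>f x\<bar>) ({a} \<union> (carrier G - {a}))
      = infsum (\<lambda>x. \<bar>f x\<bar>) {a} + infsum (\<lambda>x. \<bar>f x\<bar>) (carrier G - {a})"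
    using assms by (intro infsum_Un_disjoint ell1_summable[of f G]) auto
  moreover have "{a} \<union> (carrier G - {a}) = carrier G"
    using assms(2) by blast
  ultimately show ?thesis
    by (simp add: ell1_norm_def)
qed

lemma abs_le_ell1_norm:
  assumes "f \<in> ell1 G" and "a \<in> carrier G"
  shows "\<bar>f a\<bar> \<le> ell1_norm G f"
  using ell1_norm_split[OF assms] infsum_nonneg[of "carrier G - {a}" "\<lambda>x. \<bar>f x\<bar>"] by simp

lemma abs_add_abs_le_ell1_norm:
  assumes "f \<in> ell1 G" and "a \<in> carrier G" and "b \<in> carrier G" and "a \<noteq> b"
  shows "\<bar>f a\<bar> + \<bar>f b\<bar> \<le> ell1_norm G f"
proof -
  have "(\<Sum>x\<in>{a, b}. \<bar>f x\<bar>) \<le> ell1_norm G f"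
    unfolding ell1_norm_def
    using assms by (intro finite_sum_le_infsum ell1_summable) auto
  then show ?thesis
    using assms(4) by simp
qed

lemma ell1_norm_nonneg: "0 \<le> ell1_norm G f"
  by (simp add: ell1_norm_def infsum_nonneg)

lemma ell1_diff:
  assumes "f \<in> ell1 G" and "g \<in> ell1 G"
  shows "(\<lambda>x. f x - g x) \<in> ell1 G"
proof -
  have "(\<lambda>x. \<bar>f x\<bar> + \<bar>g x\<bar>) summable_on carrier G"
    using assms by (intro summable_on_add ell1_summable) auto
  then have "(\<lambda>x. f x - g x) abs_summable_on carrier G"
    by (rule abs_summable_on_comparison_test') simp
  then show ?thesis
    using assms by (auto simp: ell1_def)
qed

lemma ell1_norm_diff_le:
  assumes "f \<in> ell1 G" and "g \<in> ell1 G"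
  shows "ell1_norm G (\<lambda>x. f x - g x) \<le> ell1_norm G f + ell1_norm G g"
proof -
  have s: "(\<lambda>x. \<bar>f x\<bar>) summable_on carrier G" "(\<lambda>x. \<bar>g x\<bar>) summable_on carrier G"
    using assms by (auto intro: ell1_summable)
  have "ell1_norm G (\<lambda>x. f x - g x) \<le> (\<Sum>\<^sub>\<infinity>x\<in>carrier G. \<bar>f x\<bar> + \<bar>g x\<bar>)"
    unfolding ell1_norm_def
    using ell1_summable[OF ell1_diff[OF assms]] s by (intro infsum_mono summable_on_add) auto
  also have "\<dots> = ell1_norm G f + ell1_norm G g"
    unfolding ell1_norm_def using s by (rule infsum_add)
  finally show ?thesis .
qed

lemma ell1_min_zero:
  assumes "f \<in> ell1 G"
  shows "(\<lambda>x. min (f x) 0 / 2) \<in> ell1 G"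
proof -
  have "(\<lambda>x. min (f x) 0 / 2) abs_summable_on carrier G"
    using ell1_summable[OF assms subset_refl] by (rule abs_summable_on_comparison_test') auto
  then show ?thesis
    using assms by (auto simp: ell1_def)
qed

text \<open>Each function has mass at most \<open>e\<close> off \<open>a\<close>, and at
  \<open>a\<close> both values lie between \<open>1 - e\<close> and 1. This bounds the distance by
  \<open>3 * e\<close>; the stated constant leaves some slack.\<close>

lemma ell1_norm_diff_le_same_peak:
  assumes "f \<in> ell1_ball G" and "g \<in> ell1_ball G" and a: "a \<in> carrier G"
    and "1 - e \<le> f a" and "1 - e \<le> g a"
  shows "ell1_norm G (\<lambda>x. f x - g x) \<le> 4 * e"
proof -
  have fg: "f \<in> ell1 G" "g \<in> ell1 G" "ell1_norm G f \<le> 1" "ell1_norm G g \<le> 1"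
    using assms by auto
  let ?C = "carrier G - {a}"
  have s: "(\<lambda>x. \<bar>f x\<bar>) summable_on ?C" "(\<lambda>x. \<bar>g x\<bar>) summable_on ?C"
    "(\<lambda>x. \<bar>f x - g x\<bar>) summable_on ?C"
    using fg ell1_diff[OF fg(1,2)] by (auto intro: ell1_summable[of _ G] ell1_summable[of "\<lambda>x. f x - g x" G])
  have "(\<Sum>\<^sub>\<infinity>x\<in>?C. \<bar>f x - g x\<bar>) \<le> (\<Sum>\<^sub>\<infinity>x\<in>?C. \<bar>f x\<bar> + \<bar>g x\<bar>)"
    using s by (intro infsum_mono summable_on_add) auto
  also have "\<dots> = (\<Sum>\<^sub>\<infinity>x\<in>?C. \<bar>f x\<bar>) + (\<Sum>\<^sub>\<infinity>x\<in>?C. \<bar>g x\<bar>)"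
    using s by (intro infsum_add)
  finally show ?thesis
    using ell1_norm_split[OF fg(1) a] ell1_norm_split[OF fg(2) a]
      ell1_norm_split[OF ell1_diff[OF fg(1,2)] a] abs_le_ell1_norm[OF fg(1) a]
      abs_le_ell1_norm[OF fg(2) a] assms(4,5) fg(3,4)
    by linarith
qed

text \<open>The coordinate \<open>a\<close> alone suffices: the peak of \<open>g\<close> at
  \<open>b\<close> leaves \<open>g\<close> at most \<open>e\<close> of absolute value at
  \<open>a\<close>.\<close>

lemma ell1_norm_diff_ge_distinct_peaks:
  assumes "f \<in> ell1_ball G" and "g \<in> ell1_ball G" and "a \<in> carrier G" and "b \<in> carrier G"
    and "a \<noteq> b" and "1 - e \<le> f a" and "1 - e \<le> g b"
  shows "1 - 2 * e \<le> ell1_norm G (\<lambda>x. f x - g x)"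
proof -
  have fg: "f \<in> ell1 G" "g \<in> ell1 G" "ell1_norm G g \<le> 1"
    using assms by auto
  show ?thesis
    using abs_le_ell1_norm[OF ell1_diff[OF fg(1,2)] assms(3)]
      abs_add_abs_le_ell1_norm[OF fg(2) assms(3-5)] fg(3) assms(6,7)
    by linarith
qed

lemma point_mass_in_ball:
  assumes "a \<in> carrier G"
  shows "point_mass a \<in> ell1_ball G"
proof -
  have "(\<lambda>x. \<bar>point_mass a x\<bar>) summable_on carrier G \<longleftrightarrow> (\<lambda>x. \<bar>point_mass a x\<bar>) summable_on {a}"
    using assms by (intro summable_on_cong_neutral) (auto simp: point_mass_def)
  then have "point_mass a \<in> ell1 G"
    using assms by (auto simp: ell1_def point_mass_def)
  moreover have "infsum (\<lambda>x. \<bar>point_mass a x\<bar>) (carrier G) = infsum (\<lambda>x. \<bar>point_mass a x\<bar>) {a}"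
    using assms by (intro infsum_cong_neutral) (auto simp: point_mass_def)
  ultimately show ?thesis
    by (simp add: ell1_norm_def point_mass_def)
qed

section \<open>Convolution on the unit ball\<close>

context group
begin

lemma bij_betw_inv_mult:
  assumes "x \<in> carrier G"
  shows "bij_betw (\<lambda>y. inv y \<otimes> x) (carrier G) (carrier G)"
  by (rule bij_betw_byWitness[where f' = "\<lambda>z. x \<otimes> inv z"])
    (use assms in \<open>auto simp: inv_mult_group m_assoc[symmetric]\<close>, simp_all add: m_assoc)

lemma bij_betw_left_mult:
  assumes "x \<in> carrier G"
  shows "bij_betw (\<lambda>y. x \<otimes> y) (carrier G) (carrier G)"
  by (rule bij_betw_byWitness[where f' = "\<lambda>z. inv x \<otimes> z"])
    (use assms in \<open>auto simp: m_assoc[symmetric]\<close>)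

text \<open>Fubini for the kernel \<open>k\<close>: left translation preserves sums over the group,
  so summing over \<open>x\<close> first gives \<open>\<bar>f y\<bar> * ell1_norm G g\<close>, which
  is summable in \<open>y\<close>. Summing over \<open>y\<close> first dominates the
  convolution.\<close>

lemma convolution_ell1:
  assumes f: "f \<in> ell1 G" and g: "g \<in> ell1 G"
  shows "convolution G f g \<in> ell1 G"
    and "ell1_norm G (convolution G f g) \<le> ell1_norm G f * ell1_norm G g"
proof -
  let ?C = "carrier G"
  define k where "k y x = \<bar>f y\<bar> * \<bar>g (inv y \<otimes> x)\<bar>" for y x
  have gs: "(\<lambda>x. \<bar>g (inv y \<otimes> x)\<bar>) summable_on ?C" if "y \<in> ?C" for y
    using summable_on_reindex_bij_betw[OF bij_betw_left_mult, of "inv y" "\<lambda>x. \<bar>g x\<bar>"]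
      ell1_summable[OF g subset_refl] that by simp
  have gi: "(\<Sum>\<^sub>\<infinity>x\<in>?C. \<bar>g (inv y \<otimes> x)\<bar>) = ell1_norm G g" if "y \<in> ?C" for y
    using infsum_reindex_bij_betw[OF bij_betw_left_mult, of "inv y" "\<lambda>x. \<bar>g x\<bar>"] that
    by (simp add: ell1_norm_def)
  have kx: "(\<Sum>\<^sub>\<infinity>x\<in>?C. k y x) = \<bar>f y\<bar> * ell1_norm G g" if "y \<in> ?C" for y
    unfolding k_def using gi[OF that] by (simp add: infsum_cmult_right')
  have "(\<lambda>(y, x). k y x) abs_summable_on ?C \<times> ?C"
  proof (subst abs_summable_on_Sigma_iff, intro conjI ballI)
    fix y assume "y \<in> ?C"
    then show "(\<lambda>x. case (y, x) of (y, x) \<Rightarrow> k y x) abs_summable_on ?C"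
      using gs by (simp add: k_def abs_mult summable_on_cmult_right)
  next
    have "(\<lambda>y. \<bar>f y\<bar> * ell1_norm G g) summable_on ?C"
      using ell1_summable[OF f subset_refl] by (rule summable_on_cmult_left)
    then have "(\<lambda>y. \<Sum>\<^sub>\<infinity>x\<in>?C. k y x) summable_on ?C"
      using kx by (simp cong: summable_on_cong)
    then show "(\<lambda>y. \<Sum>\<^sub>\<infinity>x\<in>?C. norm (case (y, x) of (y, x) \<Rightarrow> k y x)) abs_summable_on ?C"
      by (simp add: k_def abs_mult infsum_nonneg)
  qed
  then have ks: "(\<lambda>(y, x). k y x) summable_on ?C \<times> ?C"
    by (rule abs_summable_summable)
  then have ks': "(\<lambda>(x, y). k y x) summable_on ?C \<times> ?C"
    by (subst (asm) summable_on_swap) (simp add: case_prod_unfold)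
  have sx: "(\<lambda>x. \<Sum>\<^sub>\<infinity>y\<in>?C. k y x) summable_on ?C"
    using summable_on_Sigma_banach[of "\<lambda>x y. k y x" ?C "\<lambda>_. ?C"] ks' by simp
  have sy: "(\<lambda>y. k y x) summable_on ?C" if "x \<in> ?C" for x
    using summable_on_SigmaD1[OF ks' that] by simp
  have le: "\<bar>convolution G f g x\<bar> \<le> (\<Sum>\<^sub>\<infinity>y\<in>?C. k y x)" if "x \<in> ?C" for x
    using norm_infsum_bound[of "\<lambda>y. f y * g (inv y \<otimes> x)" ?C] sy[OF that] that
    by (simp add: convolution_def k_def abs_mult)
  have "(\<lambda>x. convolution G f g x) abs_summable_on ?C"
    using sx by (rule abs_summable_on_comparison_test') (simp add: le)
  then show c: "convolution G f g \<in> ell1 G"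
    by (simp add: ell1_def convolution_def)
  have "ell1_norm G (convolution G f g) \<le> (\<Sum>\<^sub>\<infinity>x\<in>?C. \<Sum>\<^sub>\<infinity>y\<in>?C. k y x)"
    unfolding ell1_norm_def using c sx le by (intro infsum_mono ell1_summable) auto
  also have "\<dots> = (\<Sum>\<^sub>\<infinity>y\<in>?C. \<Sum>\<^sub>\<infinity>x\<in>?C. k y x)"
    using ks' by (rule infsum_swap_banach)
  also have "\<dots> = (\<Sum>\<^sub>\<infinity>y\<in>?C. \<bar>f y\<bar> * ell1_norm G g)"
    using kx by (rule infsum_cong)
  also have "\<dots> = ell1_norm G f * ell1_norm G g"
    by (simp add: infsum_cmult_left' ell1_norm_def)
  finally show "ell1_norm G (convolution G f g) \<le> ell1_norm G f * ell1_norm G g" .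
qed

lemma convolution_in_ball:
  assumes "f \<in> ell1_ball G" and "g \<in> ell1_ball G"
  shows "convolution G f g \<in> ell1_ball G"
proof -
  have "ell1_norm G f * ell1_norm G g \<le> 1"
    using assms by (intro mult_le_one) (auto simp: ell1_norm_nonneg)
  then show ?thesis
    using assms convolution_ell1[of f g] by auto
qed

lemma convolution_summable:
  assumes f: "f \<in> ell1 G" and g: "g \<in> ell1 G" and x: "x \<in> carrier G" and S: "S \<subseteq> carrier G"
  shows "(\<lambda>y. f y * g (inv y \<otimes> x)) abs_summable_on S"
proof (rule abs_summable_on_comparison_test')
  show "(\<lambda>y. \<bar>f y\<bar> * ell1_norm G g) summable_on S"
    using ell1_summable[OF f S] by (rule summable_on_cmult_left)
  fix y assume "y \<in> S"
  then show "norm (f y * g (inv y \<otimes> x)) \<le> \<bar>f y\<bar> * ell1_norm G g"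
    using S x by (auto simp: abs_mult intro!: mult_left_mono abs_le_ell1_norm[OF g])
qed

text \<open>Hoelder's inequality for the sup norm of \<open>f\<close> and the 1-norm of
  \<open>g\<close>, since \<open>y \<mapsto> inv y \<otimes> x\<close> permutes the group. It forces
  a peak on \<open>f\<close> as soon as \<open>f * g\<close> has a large value.\<close>

lemma convolution_le_sup_bound:
  assumes f: "f \<in> ell1 G" and g: "g \<in> ell1_ball G" and x: "x \<in> carrier G"
    and bound: "\<And>y. y \<in> carrier G \<Longrightarrow> \<bar>f y\<bar> \<le> c" and "0 \<le> c"
  shows "convolution G f g x \<le> c"
proof -
  have gl: "g \<in> ell1 G" "ell1_norm G g \<le> 1"
    using g by auto
  have s: "(\<lambda>y. \<bar>g (inv y \<otimes> x)\<bar>) summable_on carrier G"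
    using summable_on_reindex_bij_betw[OF bij_betw_inv_mult[OF x], of "\<lambda>z. \<bar>g z\<bar>"]
      ell1_summable[OF gl(1) subset_refl] by simp
  have i: "(\<Sum>\<^sub>\<infinity>y\<in>carrier G. \<bar>g (inv y \<otimes> x)\<bar>) = ell1_norm G g"
    using infsum_reindex_bij_betw[OF bij_betw_inv_mult[OF x], of "\<lambda>z. \<bar>g z\<bar>"]
    by (simp add: ell1_norm_def)
  have "convolution G f g x = (\<Sum>\<^sub>\<infinity>y\<in>carrier G. f y * g (inv y \<otimes> x))"
    using x by (simp add: convolution_def)
  also have "\<dots> \<le> (\<Sum>\<^sub>\<infinity>y\<in>carrier G. c * \<bar>g (inv y \<otimes> x)\<bar>)"
  proof (rule infsum_mono)
    show "(\<lambda>y. f y * g (inv y \<otimes> x)) summable_on carrier G"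
      using convolution_summable[OF f gl(1) x subset_refl] by (rule abs_summable_summable)
    show "(\<lambda>y. c * \<bar>g (inv y \<otimes> x)\<bar>) summable_on carrier G"
      using s by (rule summable_on_cmult_right)
    fix y assume "y \<in> carrier G"
    then have "\<bar>f y\<bar> * \<bar>g (inv y \<otimes> x)\<bar> \<le> c * \<bar>g (inv y \<otimes> x)\<bar>"
      using bound by (intro mult_right_mono) auto
    then show "f y * g (inv y \<otimes> x) \<le> c * \<bar>g (inv y \<otimes> x)\<bar>"
      using abs_ge_self[of "f y * g (inv y \<otimes> x)"] by (simp add: abs_mult)
  qed
  also have "\<dots> = c * ell1_norm G g"
    by (simp add: infsum_cmult_right' i)
  also have "\<dots> \<le> c"
    using gl(2) \<open>0 \<le> c\<close> by (simp add: mult_left_le)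
  finally show ?thesis .
qed

text \<open>In the sum at \<open>a \<otimes> b\<close>, the term \<open>y = a\<close> is
  \<open>f a * g b\<close>, at least \<open>1 - d - e\<close>. The other terms lose at most another
  \<open>d\<close>, the mass of \<open>f\<close> off \<open>a\<close>, because \<open>g\<close> is
  bounded by 1.\<close>

lemma convolution_peak:
  assumes f: "f \<in> ell1_ball G" and g: "g \<in> ell1_ball G"
    and a: "a \<in> carrier G" and b: "b \<in> carrier G"
    and fa: "1 - d \<le> f a" and gb: "1 - e \<le> g b"
  shows "1 - (2 * d + e) \<le> convolution G f g (a \<otimes> b)"
proof -
  have l: "f \<in> ell1 G" "ell1_norm G f \<le> 1" "g \<in> ell1 G" "ell1_norm G g \<le> 1"
    using f g by auto
  have ab: "a \<otimes> b \<in> carrier G"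
    using a b by simp
  let ?C = "carrier G - {a}" and ?h = "\<lambda>y. f y * g (inv y \<otimes> (a \<otimes> b))"
  have s: "?h abs_summable_on S" if "S \<subseteq> carrier G" for S
    using convolution_summable[OF l(1,3) ab that] .
  have "infsum ?h ({a} \<union> ?C) = infsum ?h {a} + infsum ?h ?C"
    using abs_summable_summable[OF s[of ?C]] by (intro infsum_Un_disjoint) auto
  moreover have "{a} \<union> ?C = carrier G"
    using a by blast
  moreover have "inv a \<otimes> (a \<otimes> b) = b"
    using a b by (simp add: m_assoc[symmetric])
  ultimately have c: "convolution G f g (a \<otimes> b) = f a * g b + infsum ?h ?C"
    using ab by (simp add: convolution_def)
  have "\<bar>infsum ?h ?C\<bar> \<le> (\<Sum>\<^sub>\<infinity>y\<in>?C. \<bar>?h y\<bar>)"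
    using norm_infsum_bound[OF s[of ?C]] by simp
  also have "\<dots> \<le> (\<Sum>\<^sub>\<infinity>y\<in>?C. \<bar>f y\<bar>)"
  proof (rule infsum_mono)
    show "(\<lambda>y. \<bar>?h y\<bar>) summable_on ?C"
      using s[of ?C] by simp
    show "(\<lambda>y. \<bar>f y\<bar>) summable_on ?C"
      using l(1) by (rule ell1_summable) auto
    fix y assume "y \<in> ?C"
    then have "\<bar>g (inv y \<otimes> (a \<otimes> b))\<bar> \<le> 1"
      using abs_le_ell1_norm[OF l(3), of "inv y \<otimes> (a \<otimes> b)"] l(4) ab by auto
    then show "\<bar>?h y\<bar> \<le> \<bar>f y\<bar>"
      by (simp add: abs_mult mult_left_le)
  qed
  finally have rest: "- d \<le> infsum ?h ?C"
    using ell1_norm_split[OF l(1) a] l(2) fa by linarith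
  have "f a \<le> 1" "g b \<le> 1"
    using abs_le_ell1_norm[OF l(1) a] abs_le_ell1_norm[OF l(3) b] l by auto
  \<comment> \<open>This gives \<open>f a * g b \<ge> g b - (1 - f a)\<close> whatever the signs of
    \<open>f a\<close> and \<open>g b\<close>.\<close>
  then have "(1 - f a) * g b \<le> 1 - f a"
    by (intro mult_left_le) auto
  then have "1 - d - e \<le> f a * g b"
    using fa gb by (simp add: left_diff_distrib)
  then show ?thesis
    using c rest by simp
qed

section \<open>Convolution with point masses\<close>

lemma convolution_point_mass_left:
  assumes "a \<in> carrier G" and "x \<in> carrier G"
  shows "convolution G (point_mass a) g x = g (inv a \<otimes> x)"
proof -
  have "infsum (\<lambda>y. point_mass a y * g (inv y \<otimes> x)) (carrier G)
      = infsum (\<lambda>y. point_mass a y * g (inv y \<otimes> x)) {a}"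
    using assms by (intro infsum_cong_neutral) (auto simp: point_mass_def)
  then show ?thesis
    using assms by (simp add: convolution_def point_mass_def)
qed

lemma convolution_point_mass_one_right:
  "convolution G f (point_mass \<one>) \<one> = f \<one>"
proof -
  have "infsum (\<lambda>y. f y * point_mass \<one> (inv y \<otimes> \<one>)) (carrier G)
      = infsum (\<lambda>y. f y * point_mass \<one> (inv y \<otimes> \<one>)) {\<one>}"
    by (intro infsum_cong_neutral) (auto simp: point_mass_def inv_eq_1_iff)
  then show ?thesis
    by (simp add: convolution_def point_mass_def)
qed

text \<open>Point masses multiply like group elements, so the inner convolution is the unit
  \<open>point_mass \<one>\<close>. Equality off the carrier holds because both sides vanish
  there.\<close>

lemma convolution_point_mass_inv:
  assumes a: "a \<in> carrier G" and h: "h \<in> ell1 G"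
  shows "convolution G (convolution G (point_mass a) (point_mass (inv a))) h = h"
proof
  fix x
  have "convolution G (point_mass a) (point_mass (inv a)) = point_mass \<one>"
  proof
    fix z
    show "convolution G (point_mass a) (point_mass (inv a)) z = point_mass \<one> z"
    proof (cases "z \<in> carrier G")
      case True
      then have "inv a \<otimes> z = inv a \<longleftrightarrow> z = \<one>"
        using a by (metis inv_closed l_cancel_one r_one)
      then show ?thesis
        unfolding convolution_point_mass_left[OF a True] by (simp add: point_mass_def)
    next
      case False
      then show ?thesis
        by (auto simp: point_mass_def convolution_def)
    qed
  qed
  then show "convolution G (convolution G (point_mass a) (point_mass (inv a))) h x = h x"
    using convolution_point_mass_left[of \<one> x h] h
    by (cases "x \<in> carrier G") (auto simp: convolution_def ell1_def)
qed

end

section \<open>Translation of group formulas\<close>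

fun cterm_of :: "gterm \<Rightarrow> cterm" where
  "cterm_of (GVar n) = CVar n"
| "cterm_of (GMult s t) = CConv (cterm_of s) (cterm_of t)"

text \<open>Measures how far the value of variable \<open>n\<close> is from having a right inverse
  in the ball. The language has no constant for the convolution unit, so being a unit is expressed
  by the action on every \<open>h\<close>. The bound variables are chosen distinct from
  \<open>n\<close> to avoid capture.\<close>

definition unit_defect :: "nat \<Rightarrow> cform" where
  "unit_defect n = CInf (Suc n) (CSup (Suc (Suc n))
     (CDist (CConv (CConv (CVar n) (CVar (Suc n))) (CVar (Suc (Suc n)))) (CVar (Suc (Suc n)))))"

text \<open>
  The real parameter \<open>N\<close> is the inverse of the tolerance: variables range over elements of the
  ball with a value at least \<open>1 - 1 / N\<close>. The factor 2 undoes the rescaling of the meet.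
\<close>

fun cform_of :: "real \<Rightarrow> gform \<Rightarrow> cform" where
  "cform_of N (GEq s t) =
     CConn (\<lambda>r. min 1 (max 0 (2 * r 0 - 1 / 2))) [CDist (cterm_of s) (cterm_of t)]"
| "cform_of N (GNot \<phi>) = CConn (\<lambda>r. 1 - r 0) [cform_of N \<phi>]"
| "cform_of N (GAnd \<phi> \<psi>) = CConn (\<lambda>r. max (r 0) (r 1)) [cform_of N \<phi>, cform_of N \<psi>]"
| "cform_of N (GEx n \<phi>) = CInf n
     (CConn (\<lambda>r. max (max 0 (r 0)) (N * max (r 1) (2 * r 2)))
       [cform_of N \<phi>, unit_defect n, CNorm (CMeet (CVar n) CZero)])"

text \<open>The loss in \<open>convolution_peak\<close>, accumulated along a term.\<close>

fun gterm_weight :: "gterm \<Rightarrow> nat" where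
  "gterm_weight (GVar n) = 1"
| "gterm_weight (GMult s t) = 2 * gterm_weight s + gterm_weight t"

text \<open>An upper bound for the weight of every term in the formula, so that one tolerance serves
  all its equations.\<close>

fun gform_weight :: "gform \<Rightarrow> nat" where
  "gform_weight (GEq s t) = gterm_weight s + gterm_weight t"
| "gform_weight (GNot \<phi>) = gform_weight \<phi>"
| "gform_weight (GAnd \<phi> \<psi>) = gform_weight \<phi> + gform_weight \<psi>"
| "gform_weight (GEx n \<phi>) = gform_weight \<phi>"

lemma cterm_vars_cterm_of: "cterm_vars (cterm_of t) = gterm_vars t"
  by (induction t) auto

text \<open>The auxiliary variables are bound inside \<open>unit_defect\<close>, and
  \<open>n\<close> by the outer infimum; hence sentences go to sentences.\<close>

lemma cform_fv_cform_of: "cform_fv (cform_of N \<phi>) = gform_fv \<phi>"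
  by (induction \<phi>) (auto simp: cterm_vars_cterm_of unit_defect_def)

lemma cform_wf_cform_of: "cform_wf (cform_of N \<phi>)"
  by (induction \<phi>) (auto simp: unit_defect_def intro!: continuous_intros)

lemma gterm_weight_pos: "1 \<le> gterm_weight t"
  by (induction t) auto

lemma gform_weight_pos: "1 \<le> gform_weight \<phi>"
proof (induction \<phi>)
  case (GEq s t)
  then show ?case
    using gterm_weight_pos[of s] by simp
qed auto

section \<open>Correctness of the translation\<close>

context group
begin

text \<open>The witness for the infimum is the point mass at \<open>inv a\<close>, for which the
  distance is 0 for every \<open>h\<close>.\<close>

lemma unit_defect_point_mass:
  assumes a: "a \<in> carrier G"
  shows "cform_val (convolution_algebra G) (v(n := point_mass a)) (unit_defect n) \<le> 0"
proof -
  let ?D = "\<lambda>g h. ell1_norm G (\<lambda>x. convolution G (convolution G (point_mass a) g) h x - h x)"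
  \<comment> \<open>Real suprema and infima are meaningful only for bounded nonempty sets; 2 is the
    diameter bound of the ball.\<close>
  have bdd: "bdd_above (?D g ` ell1_ball G)" if "g \<in> ell1_ball G" for g
  proof (rule bdd_aboveI2)
    fix h assume h: "h \<in> ell1_ball G"
    have c: "convolution G (convolution G (point_mass a) g) h \<in> ell1_ball G"
      using that h a by (intro convolution_in_ball point_mass_in_ball)
    show "?D g h \<le> 2"
      using ell1_norm_diff_le[of "convolution G (convolution G (point_mass a) g) h" G h] c h by auto
  qed
  have zero: "(\<lambda>x. 0) \<in> ell1_ball G"
    by (simp add: ell1_def ell1_norm_def)
  have "(INF g\<in>ell1_ball G. SUP h\<in>ell1_ball G. ?D g h) \<le> (SUP h\<in>ell1_ball G. ?D (point_mass (inv a)) h)"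
  proof (rule cINF_lower)
    show "point_mass (inv a) \<in> ell1_ball G"
      using a by (intro point_mass_in_ball) simp
    show "bdd_below ((\<lambda>g. SUP h\<in>ell1_ball G. ?D g h) ` ell1_ball G)"
    proof (rule bdd_belowI2)
      fix g assume "g \<in> ell1_ball G"
      from cSUP_upper[OF zero bdd[OF this]] show "0 \<le> (SUP h\<in>ell1_ball G. ?D g h)"
        using ell1_norm_nonneg order_trans by blast
    qed
  qed
  also have "\<dots> \<le> 0"
  proof (rule cSUP_least)
    show "ell1_ball G \<noteq> {}"
      using zero by blast
    fix h assume "h \<in> ell1_ball G"
    then show "?D (point_mass (inv a)) h \<le> 0"
      using convolution_point_mass_inv[OF a, of h] by (simp add: ell1_norm_def)
  qed
  finally show ?thesis
    by (simp add: unit_defect_def convolution_algebra_def)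
qed

text \<open>Testing a near-inverse \<open>g\<close> on \<open>h = point_mass \<one>\<close> at the
  coordinate \<open>\<one>\<close> shows that \<open>f * g\<close> exceeds \<open>1 - e\<close>
  there, so \<open>f\<close> is large in absolute value somewhere. The bound on the negative part
  then fixes the sign.\<close>

lemma peak_of_small_defect:
  assumes f: "f \<in> ell1_ball G" and e: "e \<le> 1 / 2"
    and unit: "cform_val (convolution_algebra G) (v(n := f)) (unit_defect n) < e"
    and pos: "2 * ell1_norm G (\<lambda>x. min (f x) 0 / 2) < e"
  obtains y where "y \<in> carrier G" and "1 - e \<le> f y"
proof -
  let ?D = "\<lambda>g h. ell1_norm G (\<lambda>x. convolution G (convolution G f g) h x - h x)"
  have "(INF g\<in>ell1_ball G. SUP h\<in>ell1_ball G. ?D g h) < e"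
    using unit by (simp add: unit_defect_def convolution_algebra_def)
  moreover have "point_mass \<one> \<in> ell1_ball G"
    by (intro point_mass_in_ball) simp
  ultimately obtain g where g: "g \<in> ell1_ball G" and sup: "(SUP h\<in>ell1_ball G. ?D g h) < e"
    using cInf_lessD[of "(\<lambda>g. SUP h\<in>ell1_ball G. ?D g h) ` ell1_ball G" e] by blast
  have ball: "convolution G (convolution G f g) h \<in> ell1_ball G" if "h \<in> ell1_ball G" for h
    using that f g by (intro convolution_in_ball)
  have "bdd_above (?D g ` ell1_ball G)"
  proof (rule bdd_aboveI2)
    fix h assume "h \<in> ell1_ball G"
    with ball[OF this] show "?D g h \<le> 2"
      using ell1_norm_diff_le[of "convolution G (convolution G f g) h" G h] by auto
  qed
  then have "?D g (point_mass \<one>) \<le> (SUP h\<in>ell1_ball G. ?D g h)"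
    using \<open>point_mass \<one> \<in> ell1_ball G\<close> by (intro cSUP_upper)
  then have D: "?D g (point_mass \<one>) < e"
    using sup by simp
  have "(\<lambda>x. convolution G (convolution G f g) (point_mass \<one>) x - point_mass \<one> x) \<in> ell1 G"
    using ball[OF \<open>point_mass \<one> \<in> ell1_ball G\<close>] \<open>point_mass \<one> \<in> ell1_ball G\<close> by (intro ell1_diff) auto
  from abs_le_ell1_norm[OF this one_closed] D have c: "1 - e < convolution G f g \<one>"
    by (simp add: convolution_point_mass_one_right) (simp add: point_mass_def)
  have "\<exists>y\<in>carrier G. 1 - e < \<bar>f y\<bar>"
  proof (rule ccontr)
    assume "\<not> ?thesis"
    \<comment> \<open>The sup bound is applied with \<open>c = 1 - e\<close>, nonnegative since
      \<open>e \<le> 1 / 2\<close>.\<close>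
    then have "convolution G f g \<one> \<le> 1 - e"
      using f g e by (intro convolution_le_sup_bound) (auto simp: not_less)
    then show False
      using c by simp
  qed
  then obtain y where y: "y \<in> carrier G" "1 - e < \<bar>f y\<bar>"
    by blast
  have "(\<lambda>x. min (f x) 0 / 2) \<in> ell1 G"
    using f by (intro ell1_min_zero) auto
  from abs_le_ell1_norm[OF this y(1)] pos have "\<bar>min (f y) 0\<bar> < e"
    by simp
  \<comment> \<open>A negative \<open>f y\<close> would have absolute value below \<open>e\<close>,
    but \<open>\<bar>f y\<bar> > 1 - e \<ge> e\<close>.\<close>
  then have "1 - e \<le> f y"
    using y(2) e by (auto simp: min_def split: if_splits)
  then show thesis
    using that y(1) by blast
qed

text \<open>The peak of the convolution term sits at the value of the group term. In the product
  case \<open>convolution_peak\<close> turns the losses of the factors into exactly the recursion of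
  \<open>gterm_weight\<close>.\<close>

lemma cterm_val_peak:
  fixes e :: real
  assumes "\<And>i. v i \<in> carrier G" and "\<And>i. f i \<in> ell1_ball G" and "\<And>i. 1 - e \<le> f i (v i)"
  shows "gterm_val G v t \<in> carrier G
    \<and> cterm_val (convolution_algebra G) f (cterm_of t) \<in> ell1_ball G
    \<and> 1 - gterm_weight t * e \<le> cterm_val (convolution_algebra G) f (cterm_of t) (gterm_val G v t)"
proof (induction t)
  case (GVar n)
  show ?case
    using assms(1)[of n] assms(2)[of n] assms(3)[of n] by simp
next
  case (GMult s t)
  let ?s = "cterm_val (convolution_algebra G) f (cterm_of s)"
  let ?t = "cterm_val (convolution_algebra G) f (cterm_of t)"
  have "1 - (2 * (gterm_weight s * e) + gterm_weight t * e)
      \<le> convolution G ?s ?t (gterm_val G v s \<otimes> gterm_val G v t)"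
    using GMult.IH by (intro convolution_peak) auto
  moreover have "convolution G ?s ?t \<in> ell1_ball G"
    using GMult.IH by (intro convolution_in_ball) auto
  moreover have "cterm_val (convolution_algebra G) f (cterm_of (GMult s t)) = convolution G ?s ?t"
    by (simp add: convolution_algebra_def)
  ultimately show ?case
    using GMult.IH by (simp add: algebra_simps)
qed

text \<open>The values are exactly 0 and 1, so negation, conjunction and quantifiers add no error.
  The assignment \<open>f\<close> is only near point masses because the infimum also meets such
  elements. \<open>N\<close> stays fixed through the induction.\<close>

lemma cform_val_cform_of:
  fixes N :: real
  assumes "16 * gform_weight \<phi> \<le> N"
    and "\<And>i. v i \<in> carrier G" and "\<And>i. f i \<in> ell1_ball G" and "\<And>i. 1 - 1 / N \<le> f i (v i)"
  shows "cform_val (convolution_algebra G) f (cform_of N \<phi>) = (if gsat G v \<phi> then 0 else 1)"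
  using assms
proof (induction \<phi> arbitrary: v f)
  case (GEq s t)
  let ?M = "convolution_algebra G"
  let ?s = "cterm_val ?M f (cterm_of s)" and ?t = "cterm_val ?M f (cterm_of t)"
  let ?d = "ell1_norm G (\<lambda>x. ?s x - ?t x)"
  have N: "16 * real (gterm_weight s) \<le> N" "16 * real (gterm_weight t) \<le> N" "0 < N"
    using GEq.prems(1) gterm_weight_pos[of s] gterm_weight_pos[of t] by auto
  \<comment> \<open>The factor 16 makes \<open>?d\<close> at most 1/4 for equal group values and at
    least 7/8 for distinct ones. The connective is 0 up to 1/4 and 1 from 3/4 on.\<close>
  then have w: "gterm_weight s * (1 / N) \<le> 1 / 16" "gterm_weight t * (1 / N) \<le> 1 / 16"
    by (auto simp: field_simps)
  have p: "gterm_val G v u \<in> carrier G \<and> cterm_val ?M f (cterm_of u) \<in> ell1_ball G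
      \<and> 1 - gterm_weight u * (1 / N) \<le> cterm_val ?M f (cterm_of u) (gterm_val G v u)" for u
    using GEq.prems(2-4) by (rule cterm_val_peak)
  have ps: "?s \<in> ell1_ball G" "gterm_val G v s \<in> carrier G" "1 - 1 / 16 \<le> ?s (gterm_val G v s)"
    using p[of s] w(1) by linarith+
  have pt: "?t \<in> ell1_ball G" "gterm_val G v t \<in> carrier G" "1 - 1 / 16 \<le> ?t (gterm_val G v t)"
    using p[of t] w(2) by linarith+
  have val: "cform_val ?M f (cform_of N (GEq s t)) = min 1 (max 0 (2 * ?d - 1 / 2))"
    by (simp add: convolution_algebra_def)
  show ?case
  proof (cases "gterm_val G v s = gterm_val G v t")
    case True
    then have "?d \<le> 4 * (1 / 16)"
      using ps pt by (intro ell1_norm_diff_le_same_peak) auto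
    then show ?thesis
      using True val by simp
  next
    case False
    then have "1 - 2 * (1 / 16) \<le> ?d"
      using ps pt by (intro ell1_norm_diff_ge_distinct_peaks[where a = "gterm_val G v s" and b = "gterm_val G v t"]) auto
    then show ?thesis
      using False val by simp
  qed
next
  case (GNot \<phi>)
  have "cform_val (convolution_algebra G) f (cform_of N \<phi>) = (if gsat G v \<phi> then 0 else 1)"
    using GNot.prems by (intro GNot.IH) simp_all
  then show ?case
    by simp
next
  case (GAnd \<phi> \<psi>)
  have "cform_val (convolution_algebra G) f (cform_of N \<phi>) = (if gsat G v \<phi> then 0 else 1)"
    using GAnd.prems by (intro GAnd.IH(1)) simp_all
  moreover have "cform_val (convolution_algebra G) f (cform_of N \<psi>) = (if gsat G v \<psi> then 0 else 1)"
    using GAnd.prems by (intro GAnd.IH(2)) simp_all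
  ultimately show ?case
    by simp
next
  case (GEx n \<phi>)
  let ?M = "convolution_algebra G"
  have "16 * gform_weight \<phi> \<le> N"
    using GEx.prems(1) by simp
  then have "16 \<le> N"
    using gform_weight_pos[of \<phi>] by linarith
  let ?T = "\<lambda>h. cform_val ?M (f(n := h)) (cform_of N \<phi>)"
  let ?U = "\<lambda>h. cform_val ?M (f(n := h)) (unit_defect n)"
  let ?P = "\<lambda>h. ell1_norm G (\<lambda>x. min (h x) 0 / 2)"
  \<comment> \<open>Far from point masses \<open>?T h\<close> is not estimated: \<open>max 0\<close>
    keeps \<open>?F\<close> nonnegative there, and the penalty makes it at least 1.\<close>
  let ?F = "\<lambda>h. max (max 0 (?T h)) (N * max (?U h) (2 * ?P h))"
  have val: "cform_val ?M f (cform_of N (GEx n \<phi>)) = (INF h\<in>ell1_ball G. ?F h)"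
    by (simp add: convolution_algebra_def)
  have T: "?T h = (if gsat G (v(n := a)) \<phi> then 0 else 1)"
    if "a \<in> carrier G" "h \<in> ell1_ball G" "1 - 1 / N \<le> h a" for a h
    using that GEx.prems by (intro GEx.IH) auto
  \<comment> \<open>The penalty vanishes at point masses, so in both cases below the infimum is
    attained at one of them.\<close>
  have at_point_mass: "?F (point_mass a) = (if gsat G (v(n := a)) \<phi> then 0 else 1)"
    if a: "a \<in> carrier G" for a
  proof -
    have "?P (point_mass a) = 0"
      by (simp add: ell1_norm_def point_mass_def)
    then have "max (?U (point_mass a)) (2 * ?P (point_mass a)) = 0"
      using unit_defect_point_mass[OF a, of f n] by simp
    moreover have "1 - 1 / N \<le> point_mass a a"
      using \<open>16 \<le> N\<close> by (simp add: point_mass_def)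
    ultimately show ?thesis
      using T[OF a point_mass_in_ball[OF a]] by auto
  qed
  show ?case
  proof (cases "gsat G v (GEx n \<phi>)")
    case True
    then obtain a where a: "a \<in> carrier G" "gsat G (v(n := a)) \<phi>"
      by auto
    have "(INF h\<in>ell1_ball G. ?F h) = 0"
    proof (rule cInf_eq_minimum)
      show "0 \<in> ?F ` ell1_ball G"
        using at_point_mass[OF a(1)] a(2) point_mass_in_ball[OF a(1)] by (intro image_eqI) auto
    qed auto
    then show ?thesis
      using val True by simp
  next
    case False
    then have no: "\<not> gsat G (v(n := a)) \<phi>" if "a \<in> carrier G" for a
      using that by auto
    have "(INF h\<in>ell1_ball G. ?F h) = 1"
    proof (rule cInf_eq_minimum)
      show "1 \<in> ?F ` ell1_ball G"
        using at_point_mass[OF one_closed] no[OF one_closed] point_mass_in_ball[OF one_closed]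
        by (intro image_eqI) auto
      fix r assume "r \<in> ?F ` ell1_ball G"
      then obtain h where h: "h \<in> ell1_ball G" and r: "r = ?F h"
        by blast
      show "1 \<le> r"
      \<comment> \<open>Below \<open>1 / N\<close>, \<open>h\<close> has a peak at some
        \<open>a\<close> and the induction hypothesis gives \<open>?T h = 1\<close>; otherwise the
        penalty alone reaches 1.\<close>
      proof (cases "max (?U h) (2 * ?P h) < 1 / N")
        case True
        have "1 / N \<le> 1 / 2"
          using \<open>16 \<le> N\<close> by simp
        from True obtain a where "a \<in> carrier G" "1 - 1 / N \<le> h a"
          using peak_of_small_defect[OF h \<open>1 / N \<le> 1 / 2\<close>, of f n] by auto
        then have "?T h = 1"
          using T[OF _ h] no by simp
        then show ?thesis
          using r by simp
      next
        case large: False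
        then have "1 \<le> N * max (?U h) (2 * ?P h)"
          using \<open>16 \<le> N\<close> by (simp add: not_less field_simps del: less_max_iff_disj max_less_iff_conj)
        then show ?thesis
          using r by simp
      qed
    qed
    then show ?thesis
      using val False by simp
  qed
qed

lemma cform_val_point_masses:
  assumes "range v \<subseteq> carrier G"
  shows "cform_val (convolution_algebra G) (\<lambda>i. point_mass (v i)) (cform_of (16 * gform_weight \<phi>) \<phi>)
    = (if gsat G v \<phi> then 0 else 1)"
proof (rule cform_val_cform_of)
  show "v i \<in> carrier G" for i
    using assms by blast
  then show "point_mass (v i) \<in> ell1_ball G" for i
    by (rule point_mass_in_ball)
qed (simp_all add: point_mass_def)

end

section \<open>Transfer from the convolution algebras to the groups\<close>

theorem corollary3p17:
  fixes G :: "('a, 'm) monoid_scheme" and H :: "('b, 'n) monoid_scheme"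
  assumes "group G" and "group H"
    and "cnv_elem_equiv (convolution_algebra G) (convolution_algebra H)"
  shows "grp_elem_equiv G H"
  unfolding grp_elem_equiv_def
proof (intro allI impI)
  fix \<phi> and v :: "nat \<Rightarrow> 'a" and w :: "nat \<Rightarrow> 'b"
  assume \<phi>: "gsentence \<phi>" and v: "range v \<subseteq> carrier G" and w: "range w \<subseteq> carrier H"
  \<comment> \<open>The tolerance depends only on \<open>\<phi>\<close>, so the same sentence is
    evaluated in both algebras; its values 0 and 1 then determine truth in each group.\<close>
  let ?T = "cform_of (16 * gform_weight \<phi>) \<phi>"
  have "csentence ?T"
    using \<phi> by (simp add: csentence_def gsentence_def cform_wf_cform_of cform_fv_cform_of)
  moreover have "range (\<lambda>i. point_mass (v i)) \<subseteq> cuniv (convolution_algebra G)"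
    using v by (auto simp: convolution_algebra_def dest: point_mass_in_ball)
  moreover have "range (\<lambda>i. point_mass (w i)) \<subseteq> cuniv (convolution_algebra H)"
    using w by (auto simp: convolution_algebra_def dest: point_mass_in_ball)
  ultimately have "cform_val (convolution_algebra G) (\<lambda>i. point_mass (v i)) ?T
      = cform_val (convolution_algebra H) (\<lambda>i. point_mass (w i)) ?T"
    using assms(3) unfolding cnv_elem_equiv_def by blast
  then show "gsat G v \<phi> = gsat H w \<phi>"
    using group.cform_val_point_masses[OF assms(1) v, of \<phi>]
      group.cform_val_point_masses[OF assms(2) w, of \<phi>]
    by (auto split: if_splits)
qed

end
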